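(* For every positive integer $n$, the path $P_n$ on $n$ vertices satisfies $\mathcal{G}(P_n)=n\bmod 2$ for \textsc{Closed Geodetic Game}.
   Context: For vertices $x,y$, $\mathcal{I}(x,y)$ is the set of vertices on some shortest $x$–$y$ path ($\mathcal{I}(x,x)=\{x\}$); for a vertex set $S$, the geodetic closure is $(S)=\bigcup_{x,y\in S}\mathcal{I}(x,y)$. \textsc{Closed Geodetic Game} on a graph: starting from $S=\emptyset$, two players alternately add to $S$ a vertex not in the current closure $(S)$; when $(S)$ is the whole vertex set there is no legal move and the game ends; the player making the last move wins. The options of a position are the positions reachable by one legal move; the Sprague–Grundy value is $\mathcal{G}(P)=\operatorname{mex}\{\mathcal{G}(P'):P'\text{ an option of }P\}$, where $\operatorname{mex}(X)$ is the least nonnegative integer not in $X$. $\mathcal{G}(H)$ for a graph $H$ denotes the value of the initial position (nothing selected). *)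

theory Defs
  imports "Graph_Theory.Graph_Theory"
begin

text \<open>
  A finite simple graph is a \<open>pair_graph\<close>: a finite loop-free digraph without parallel
  arcs whose arc relation is symmetric.
\<close>

definition shortest_vpath :: "'a pair_pre_digraph \<Rightarrow> 'a \<Rightarrow> 'a list \<Rightarrow> 'a \<Rightarrow> bool" where
  "shortest_vpath G x p y \<longleftrightarrow>
     vpath p (with_proj G) \<and> hd p = x \<and> last p = y \<and>
     (\<forall>q. vpath q (with_proj G) \<and> hd q = x \<and> last q = y \<longrightarrow> vwalk_length p \<le> vwalk_length q)"

definition geodetic_interval :: "'a pair_pre_digraph \<Rightarrow> 'a \<Rightarrow> 'a \<Rightarrow> 'a set" where
  "geodetic_interval G x y = {v. \<exists>p. shortest_vpath G x p y \<and> v \<in> set p}"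

definition geodetic_closure :: "'a pair_pre_digraph \<Rightarrow> 'a set \<Rightarrow> 'a set" where
  "geodetic_closure G S = (\<Union>x\<in>S. \<Union>y\<in>S. geodetic_interval G x y)"

definition closed_geodetic_succs :: "'a pair_pre_digraph \<Rightarrow> 'a set \<Rightarrow> 'a set set" where
  "closed_geodetic_succs G S = {insert v S | v. v \<in> pverts G - geodetic_closure G S}"

definition mex :: "nat set \<Rightarrow> nat" where
  "mex X = (LEAST k. k \<notin> X)"

text \<open>
  The Sprague--Grundy value for normal play, for an option function \<open>opts\<close>, by well-founded
  recursion. The recursion equation is \<open>sprague_grundy_unfold\<close>; it requires that no infinite
  play exists, which \<open>wf_closed_geodetic_succs\<close> establishes for every finite graph.
\<close>

definition sprague_grundy :: "('p \<Rightarrow> 'p set) \<Rightarrow> 'p \<Rightarrow> nat" where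
  "sprague_grundy opts = wfrec {(Q, P). Q \<in> opts P} (\<lambda>g P. mex (g ` opts P))"

lemma sprague_grundy_unfold:
  assumes "wf {(Q, P). Q \<in> opts P}"
  shows "sprague_grundy opts P = mex (sprague_grundy opts ` opts P)"
proof -
  let ?R = "{(Q, P). Q \<in> opts P}"
  have "cut (sprague_grundy opts) ?R P ` opts P = sprague_grundy opts ` opts P"
    by (intro image_cong) (auto simp: cut_apply)
  then show ?thesis
    using wfrec[OF assms, of "\<lambda>g P. mex (g ` opts P)" P]
    by (simp add: sprague_grundy_def)
qed

lemma geodetic_closure_extensive:
  assumes "v \<in> pverts G" and "v \<in> S"
  shows "v \<in> geodetic_closure G S"
proof -
  have "shortest_vpath G v [v] v"
    using assms(1) by (auto simp: shortest_vpath_def vpath_def vwalk_def)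
  then have "v \<in> geodetic_interval G v v"
    unfolding geodetic_interval_def by (metis (mono_tags) CollectI list.set_intros(1))
  then show ?thesis
    using assms(2) by (auto simp: geodetic_closure_def)
qed

lemma wf_closed_geodetic_succs:
  assumes "finite (pverts G)"
  shows "wf {(T, S). T \<in> closed_geodetic_succs G S}"
proof (rule wf_subset)
  show "wf (measure (\<lambda>S. card (pverts G - S)))" by simp
  show "{(T, S). T \<in> closed_geodetic_succs G S} \<subseteq> measure (\<lambda>S. card (pverts G - S))"
  proof clarsimp
    fix T S assume "T \<in> closed_geodetic_succs G S"
    then obtain v where v: "T = insert v S" "v \<in> pverts G" "v \<notin> geodetic_closure G S"
      by (auto simp: closed_geodetic_succs_def)
    with geodetic_closure_extensive have "v \<notin> S" by metis
    with v have "pverts G - T \<subset> pverts G - S" by auto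
    then show "card (pverts G - T) < card (pverts G - S)"
      using assms by (intro psubset_card_mono) auto
  qed
qed

definition closed_geodetic_value :: "'a pair_pre_digraph \<Rightarrow> nat" where
  "closed_geodetic_value G = sprague_grundy (closed_geodetic_succs G) {}"

definition path_graph :: "nat \<Rightarrow> nat pair_pre_digraph" where
  "path_graph n =
     \<lparr> pverts = {0..<n}, parcs = {(i, j). i < n \<and> j < n \<and> (j = Suc i \<or> i = Suc j)} \<rparr>"

lemma pair_graph_path_graph: "pair_graph (path_graph n)"
proof
  show "finite (parcs (path_graph n))"
    by (rule finite_subset[of _ "{0..<n} \<times> {0..<n}"]) (auto simp: path_graph_def)
  show "symmetric (with_proj (path_graph n))"
    by (auto simp: symmetric_def path_graph_def intro!: symI)
qed (auto simp: path_graph_def)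

end

theory Submission
  imports Defs
begin

text \<open>
  The geodetic closure of a nonempty set of vertices of a path is the interval it spans, so a
  position with minimum \<open>a\<close> and maximum \<open>b\<close> is a sum of two Nim heaps of sizes \<open>a\<close> and
  \<open>n - 1 - b\<close>, one for each end of the path. Hence the options of the initial position have the
  values \<open>a XOR (n - 1 - a)\<close> for \<open>a < n\<close>. All of them have the parity of \<open>n - 1\<close>, and for odd
  \<open>n\<close> the midpoint yields \<open>0\<close>.
\<close>

unbundle bit_operations_syntax

section \<open>Geodetic closure in a path\<close>

text \<open>A discrete intermediate value argument: consecutive vertices of a walk differ by one, so
  prepending a vertex extends the spanned interval by at most that vertex.\<close>

lemma atLeastAtMost_subset_vwalk_path_graph:
  assumes "vwalk p (path_graph n)"
  shows "{min (hd p) (last p)..max (hd p) (last p)} \<subseteq> set p"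
  using assms
proof (induct rule: vwalk_induct)
  case (Base u)
  then show ?case by simp
next
  case (Cons u v es)
  let ?w = "last (v # es)"
  have "u = Suc v \<or> v = Suc u"
    using Cons(1) by (auto simp: path_graph_def)
  then have "{min u ?w..max u ?w} \<subseteq> insert u {min v ?w..max v ?w}"
    by (auto simp: min_def max_def split: if_splits)
  also have "\<dots> \<subseteq> set (u # v # es)"
    using Cons(2) by auto
  finally show ?case by simp
qed

lemma monotone_vpath_path_graph:
  assumes "x \<le> y" "y < n"
  shows "\<exists>p. vpath p (path_graph n) \<and> hd p = x \<and> last p = y \<and> set p = {x..y}"
  using assms(1)
proof (induct rule: inc_induct)
  case base
  have "vpath [y] (path_graph n)"
    using assms(2) by (auto simp: vpath_def vwalk_def path_graph_def)
  then show ?case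
    by (intro exI[of _ "[y]"]) simp
next
  case (step x)
  then obtain p where p: "vpath p (path_graph n)" "hd p = Suc x" "last p = y" "set p = {Suc x..y}"
    by blast
  have "p \<noteq> []"
    using p(1) by (auto simp: vpath_def vwalk_def)
  moreover have "vpath (x # p) (path_graph n)"
    using p step(2) assms(2) by (auto simp: vpath_def path_graph_def intro!: vwalk_consI)
  moreover have "set (x # p) = {x..y}"
    using p(4) step(2) by auto
  ultimately show ?case
    using p(3) by (intro exI[of _ "x # p"]) simp
qed

lemma vpath_path_graph:
  assumes "x < n" "y < n"
  shows "\<exists>p. vpath p (path_graph n) \<and> hd p = x \<and> last p = y \<and> set p = {min x y..max x y}"
proof (cases "x \<le> y")
  case True
  then show ?thesis
    using monotone_vpath_path_graph[of x y n] assms by simp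
next
  case False
  then obtain p where p: "vpath p (path_graph n)" "hd p = y" "last p = x" "set p = {y..x}"
    using monotone_vpath_path_graph[of y x n] assms by auto
  have "vpath (rev p) (path_graph n)"
    using p(1) by (auto simp: vpath_def vwalk_def set_vwalk_arcs_rev path_graph_def)
  moreover have "p \<noteq> []"
    using p(1) by (auto simp: vpath_def vwalk_def)
  ultimately show ?thesis
    using p False by (intro exI[of _ "rev p"]) (simp add: hd_rev last_rev)
qed

text \<open>A path has distinct vertices, so its length is governed by the size of its vertex set.
  That set contains the whole interval, and the monotone path attains equality; hence a shortest
  path has exactly the interval as its vertex set.\<close>

lemma geodetic_interval_path_graph:
  assumes "x < n" "y < n"
  shows "geodetic_interval (path_graph n) x y = {min x y..max x y}"
proof -
  let ?I = "{min x y..max x y}"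
  obtain p where p: "vpath p (path_graph n)" "hd p = x" "last p = y" "set p = ?I"
    using vpath_path_graph[OF assms] by blast
  have sub: "?I \<subseteq> set q" and len: "length q = card (set q)"
    if "vpath q (path_graph n)" "hd q = x" "last q = y" for q
    using that atLeastAtMost_subset_vwalk_path_graph[of q n]
    by (auto simp: vpath_def distinct_card)
  have le: "length p \<le> length q"
    if "vpath q (path_graph n)" "hd q = x" "last q = y" for q
    using card_mono[OF _ sub[OF that]] len[OF that] len[OF p(1-3)] p(4) by simp
  have "shortest_vpath (path_graph n) x p y"
    using p le by (auto simp: shortest_vpath_def intro!: diff_le_mono)
  moreover have "set q = ?I" if q: "shortest_vpath (path_graph n) x q y" for q
  proof -
    \<comment> \<open>\<open>vwalk_length\<close> is a truncated \<open>length - 1\<close>, so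
      comparing the lists themselves requires \<open>p\<close> to be nonempty.\<close>
    have q': "vpath q (path_graph n)" "hd q = x" "last q = y" "length q - 1 \<le> length p - 1"
      using q p by (auto simp: shortest_vpath_def)
    moreover have "p \<noteq> []"
      using p(1) by (auto simp: vpath_def vwalk_def)
    ultimately have "length q \<le> length p"
      by (cases p) auto
    then have "card (set q) \<le> card ?I"
      using len[OF q'(1-3)] len[OF p(1-3)] p(4) by simp
    then show ?thesis
      using card_seteq[of "set q" ?I] sub[OF q'(1-3)] by simp
  qed
  ultimately show ?thesis
    using p(4) by (auto simp: geodetic_interval_def)
qed

lemma geodetic_closure_path_graph:
  assumes "S \<subseteq> {0..<n}" "S \<noteq> {}"
  shows "geodetic_closure (path_graph n) S = {Min S..Max S}"
proof -
  have fin: "finite S"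
    using assms(1) finite_subset by blast
  have "geodetic_closure (path_graph n) S = (\<Union>x\<in>S. \<Union>y\<in>S. {min x y..max x y})"
    using assms(1) unfolding geodetic_closure_def
    by (intro SUP_cong refl geodetic_interval_path_graph) auto
  also have "\<dots> = {Min S..Max S}"
  proof
    show "(\<Union>x\<in>S. \<Union>y\<in>S. {min x y..max x y}) \<subseteq> {Min S..Max S}"
      using fin by (auto simp: min_le_iff_disj le_max_iff_disj
          intro: order_trans[OF Min_le] order_trans[OF _ Max_ge])
    \<comment> \<open>The single pair of extreme elements already covers everything.\<close>
    have "{min (Min S) (Max S)..max (Min S) (Max S)} = {Min S..Max S}"
      using fin assms(2) by (simp add: min_def max_def)
    then show "{Min S..Max S} \<subseteq> (\<Union>x\<in>S. \<Union>y\<in>S. {min x y..max x y})"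
      using fin assms(2) Min_in[of S] Max_in[of S] by blast
  qed
  finally show ?thesis .
qed

lemma closed_geodetic_succs_path_graph:
  assumes "S \<subseteq> {0..<n}" "S \<noteq> {}"
  shows "closed_geodetic_succs (path_graph n) S =
    (\<lambda>v. insert v S) ` ({0..<Min S} \<union> {Max S<..<n})"
proof -
  have "Min S < n"
    using assms Min_in[of S] finite_subset by fastforce
  then have "{0..<n} - {Min S..Max S} = {0..<Min S} \<union> {Max S<..<n}"
    by auto
  moreover have "pverts (path_graph n) = {0..<n}"
    by (simp add: path_graph_def)
  ultimately show ?thesis
    unfolding closed_geodetic_succs_def geodetic_closure_path_graph[OF assms]
    by auto
qed

section \<open>Two heaps of Nim\<close>

lemma mex_eqI:
  assumes "k \<notin> X" "\<And>j. j < k \<Longrightarrow> j \<in> X"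
  shows "mex X = k"
  unfolding mex_def using assms by (intro Least_equality) (auto simp: not_less[symmetric])

text \<open>The key property of Nim: every value below the Nim sum is reached by shrinking one heap.
  The induction strips the lowest binary digit.\<close>

lemma less_xor_cases:
  fixes a b k :: nat
  assumes "k < a XOR b"
  shows "k XOR b < a \<or> k XOR a < b"
  using assms
proof (induct k arbitrary: a b rule: less_induct)
  case (less k)
  have rec: "x XOR y = of_bool (odd x \<noteq> odd y) + 2 * ((x div 2) XOR (y div 2))" for x y :: nat
    by (rule xor_rec)
  show ?case
  proof (cases "k div 2 < (a div 2) XOR (b div 2)")
    case True
    \<comment> \<open>The induction hypothesis applies to \<open>k div 2\<close> only if
      \<open>k\<close> is nonzero. For \<open>k = 0\<close> the claim is that the distinct numbers
      \<open>a div 2\<close> and \<open>b div 2\<close> are ordered one way or the other.\<close>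
    have "(k div 2) XOR (b div 2) < a div 2 \<or> (k div 2) XOR (a div 2) < b div 2"
    proof (cases "k = 0")
      case True
      then show ?thesis
        using \<open>k div 2 < (a div 2) XOR (b div 2)\<close>
        by (cases "a div 2" "b div 2" rule: linorder_cases) auto
    next
      case False
      then show ?thesis
        using less(1)[of "k div 2"] True by simp
    qed
    moreover have "(k XOR b) div 2 = (k div 2) XOR (b div 2)"
      "(k XOR a) div 2 = (k div 2) XOR (a div 2)"
      using rec[of k b] rec[of k a] by simp_all
    ultimately have "(k XOR b) div 2 < a div 2 \<or> (k XOR a) div 2 < b div 2"
      by simp
    then show ?thesis
      using div_le_mono[of a "k XOR b" 2] div_le_mono[of b "k XOR a" 2] by linarith
  next
    case False
    \<comment> \<open>Now \<open>k\<close> differs from \<open>a XOR b\<close> only in the lowest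
      bit, which is 0 in \<open>k\<close>. Exactly one of \<open>a\<close> and \<open>b\<close> is
      odd, and that heap shrinks by one.\<close>
    then have "2 * ((a div 2) XOR (b div 2)) \<le> k"
      by linarith
    then have "odd a \<noteq> odd b" "k = 2 * ((a div 2) XOR (b div 2))"
      using less(2) rec[of a b] by (simp_all add: of_bool_def split: if_splits)
    then have k: "k div 2 = (a div 2) XOR (b div 2)" "even k" "odd a \<noteq> odd b"
      by simp_all
    have "(k div 2) XOR (b div 2) = a div 2"
      by (simp add: k(1) xor.assoc)
    moreover have "(k div 2) XOR (a div 2) = b div 2"
      by (simp add: k(1) xor.commute[of "a div 2"] xor.assoc)
    ultimately show ?thesis
      using rec[of k b] rec[of k a] k by (auto elim!: oddE)
  qed
qed

text \<open>XOR with a fixed number is an involution, so changing one heap changes the sum; smaller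
  values come from \<open>less_xor_cases\<close>.\<close>

lemma mex_nim_sum:
  fixes a b :: nat
  shows "mex ((\<lambda>i. i XOR b) ` {0..<a} \<union> (\<lambda>j. a XOR j) ` {0..<b}) = a XOR b"
proof (rule mex_eqI)
  have "i = a" if "a XOR b = i XOR b" for i
    using arg_cong[OF that, of "\<lambda>t. t XOR b"] by (simp add: xor.assoc)
  moreover have "j = b" if "a XOR b = a XOR j" for j
    using arg_cong[OF that, of "\<lambda>t. a XOR t"] by (simp flip: xor.assoc)
  ultimately show "a XOR b \<notin> (\<lambda>i. i XOR b) ` {0..<a} \<union> (\<lambda>j. a XOR j) ` {0..<b}"
    by fastforce
next
  fix k
  assume "k < a XOR b"
  then have "k XOR b < a \<or> k XOR a < b"
    by (rule less_xor_cases)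
  moreover have "k = (k XOR b) XOR b"
    by (simp add: xor.assoc)
  moreover have "k = a XOR (k XOR a)"
    by (simp add: xor.left_commute[of a k a])
  ultimately show "k \<in> (\<lambda>i. i XOR b) ` {0..<a} \<union> (\<lambda>j. a XOR j) ` {0..<b}"
    by (metis UnI1 UnI2 atLeastLessThan_iff imageI zero_le)
qed

section \<open>The value of a path\<close>

lemma sprague_grundy_path_graph_unfold:
  "sprague_grundy (closed_geodetic_succs (path_graph n)) S =
    mex (sprague_grundy (closed_geodetic_succs (path_graph n)) `
      closed_geodetic_succs (path_graph n) S)"
  by (intro sprague_grundy_unfold wf_closed_geodetic_succs) (simp add: path_graph_def)

lemma sprague_grundy_path_graph:
  assumes "S \<subseteq> {0..<n}" "S \<noteq> {}"
  shows "sprague_grundy (closed_geodetic_succs (path_graph n)) S = Min S XOR (n - 1 - Max S)"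
  using assms
\<comment> \<open>The measure counts the vertices outside the closure. A move at either end shrinks
  one heap and leaves the other unchanged.\<close>
proof (induct "Min S + (n - 1 - Max S)" arbitrary: S rule: less_induct)
  case less
  let ?g = "sprague_grundy (closed_geodetic_succs (path_graph n))"
  let ?a = "Min S" and ?b = "n - 1 - Max S"
  have fin: "finite S"
    using less(2) finite_subset by blast
  have mm: "Min S \<in> S" "Max S \<in> S"
    using fin less(3) by simp_all
  then have lt: "Max S < n" "Min S \<le> Max S"
    using less(2) fin by auto
  have left: "?g (insert v S) = v XOR ?b" if "v < Min S" for v
  proof -
    have "Min (insert v S) = v" "Max (insert v S) = Max S"
      using that fin less(3) lt by simp_all
    then show ?thesis
      using less(1)[of "insert v S"] less(2) that lt by auto
  qed
  have right: "?g (insert v S) = ?a XOR (n - 1 - v)" if "Max S < v" "v < n" for v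
  proof -
    have "Min (insert v S) = Min S" "Max (insert v S) = v"
      using that fin less(3) lt by simp_all
    then show ?thesis
      using less(1)[of "insert v S"] less(2) that by auto
  qed
  have "?g ` closed_geodetic_succs (path_graph n) S =
      (\<lambda>v. v XOR ?b) ` {0..<?a} \<union> (\<lambda>v. ?a XOR (n - 1 - v)) ` {Max S<..<n}"
    unfolding closed_geodetic_succs_path_graph[OF less(2,3)] image_image image_Un
    using left right by (intro arg_cong2[of _ _ _ _ "(\<union>)"] image_cong) auto
  also have "(\<lambda>v. ?a XOR (n - 1 - v)) ` {Max S<..<n} = (\<lambda>j. ?a XOR j) ` {0..<?b}"
  proof -
    \<comment> \<open>Reindexing by the number of vertices to the right of \<open>v\<close> turns
      the right-hand moves into all smaller heap sizes.\<close>
    have "(\<lambda>v. n - 1 - v) ` {Max S<..<n} = {0..<?b}"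
    proof (intro equalityI subsetI)
      fix j
      assume "j \<in> {0..<?b}"
      then have "j = n - 1 - (n - 1 - j)" "n - 1 - j \<in> {Max S<..<n}"
        by auto
      then show "j \<in> (\<lambda>v. n - 1 - v) ` {Max S<..<n}"
        by (rule image_eqI)
    qed auto
    then show ?thesis
      by (metis image_image)
  qed
  finally show ?case
    by (simp only: sprague_grundy_path_graph_unfold[of n S] mex_nim_sum)
qed

theorem theorem4:
  fixes n :: nat
  assumes "n > 0"
  shows "closed_geodetic_value (path_graph n) = n mod 2"
proof -
  let ?g = "sprague_grundy (closed_geodetic_succs (path_graph n))"
  \<comment> \<open>The closure of the empty set is empty, so every vertex is a legal first
    move.\<close>
  have "closed_geodetic_succs (path_graph n) {} = (\<lambda>v. {v}) ` {0..<n}"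
    by (auto simp: closed_geodetic_succs_def geodetic_closure_def path_graph_def)
  then have "?g ` closed_geodetic_succs (path_graph n) {} = (\<lambda>v. ?g {v}) ` {0..<n}"
    by (simp add: image_image)
  also have "\<dots> = (\<lambda>v. v XOR (n - 1 - v)) ` {0..<n}"
    by (intro image_cong) (simp_all add: sprague_grundy_path_graph)
  finally have grundy: "closed_geodetic_value (path_graph n) =
      mex ((\<lambda>v. v XOR (n - 1 - v)) ` {0..<n})"
    using sprague_grundy_path_graph_unfold[of n "{}"] by (simp add: closed_geodetic_value_def)
  have parity: "even (v XOR (n - 1 - v)) \<longleftrightarrow> odd n" if "v < n" for v
  proof -
    \<comment> \<open>XOR and addition agree in the lowest bit, and the two heaps have
      \<open>n - 1\<close> vertices in total.\<close>
    have "even (v XOR (n - 1 - v)) \<longleftrightarrow> even (v + (n - 1 - v))"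
      by (simp add: even_xor_iff)
    then show ?thesis
      using that by auto
  qed
  have "mex ((\<lambda>v. v XOR (n - 1 - v)) ` {0..<n}) = n mod 2"
  proof (rule mex_eqI)
    show "n mod 2 \<notin> (\<lambda>v. v XOR (n - 1 - v)) ` {0..<n}"
    proof
      assume "n mod 2 \<in> (\<lambda>v. v XOR (n - 1 - v)) ` {0..<n}"
      then obtain v where "v < n" "n mod 2 = v XOR (n - 1 - v)"
        by auto
      then show False
        using parity[of v] by presburger
    qed
  next
    fix j
    assume "j < n mod 2"
    then have "j = 0" "odd n"
      by presburger+
    \<comment> \<open>The midpoint \<open>m\<close> leaves two equal heaps of size \<open>m\<close>,
      whose Nim sum is 0.\<close>
    moreover from \<open>odd n\<close> obtain m where "n = 2 * m + 1"
      by (rule oddE)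
    ultimately show "j \<in> (\<lambda>v. v XOR (n - 1 - v)) ` {0..<n}"
      by (intro image_eqI[of _ _ m]) simp_all
  qed
  with grundy show ?thesis
    by simp
qed

end
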